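(* Let $n\ge1$, $p>1$, let $\Omega\subset\mathbb{R}^{n+1}$ be an arbitrary domain and let $\sigma>1$. If $u\in\mathrm{PBMO}^{\sigma}(\Omega)$, then $u\in\mathrm{PBMO}(\Omega)=\mathrm{PBMO}^{1}(\Omega)$.
   Context: $|E|$ is Lebesgue measure on $\mathbb{R}^{n+1}$, $d\mu=dx\,dt$, $(v)^+=\max\{v,0\}$. Points of $\mathbb{R}^{n+1}$ are written $(x,t)$ with $x\in\mathbb{R}^n$ (space), $t\in\mathbb{R}$ (time). Parabolic rectangles: $p>1$ is fixed. For a cube $Q=Q(x,L)\subset\mathbb{R}^n$ (sides parallel to the axes) with center $x$ and sidelength $L>0$, the parabolic rectangle centered at $(x,t)$ with sidelength $L$ is $R=Q\times(t-L^p,t+L^p)$. Its upper quarter is $S^+=\{(y,\tau)\in R:\tau>t+\tfrac12L^p\}$ and its lower quarter is $S^-=\{(y,\tau)\in R:\tau<t-\tfrac12L^p\}$. For $\lambda>0$, $\lambda R=(\lambda Q)\times(t-(\lambda L)^p,t+(\lambda L)^p)$, where $\lambda Q$ is the concentric cube with sidelength $\lambda L$. Parabolic BMO: for $\sigma\ge1$ and a domain $\Omega\subset\mathbb{R}^{n+1}$, $u\in L^1_{loc}(\Omega)$ belongs to $\mathrm{PBMO}^\sigma(\Omega)$ if for each parabolic rectangle $R$ there is a constant $a_R\in\mathbb{R}$ such that $$\sup_{\sigma R\subset\Omega}\left(\frac{1}{|S^+|}\int_{S^+}(u-a_R)^+\,d\mu+\frac{1}{|S^-|}\int_{S^-}(a_R-u)^+\,d\mu\right)<\infty,$$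 the supremum being over parabolic rectangles $R$ with $\sigma R\subset\Omega$. For $\sigma=1$ the superscript is omitted. *)

theory Defs
  imports "HOL-Analysis.Analysis"
begin

text \<open>Space-time \<open>\<real>\<^sup>n \<times> \<real>\<close> is the type \<open>(real ^ 'n) \<times> real\<close>, where \<open>n = CARD('n) \<ge> 1\<close>.
  Lebesgue measure is the completed measure \<open>lebesgue\<close> of this Euclidean space.\<close>

definition cube :: "real ^ 'n \<Rightarrow> real \<Rightarrow> (real ^ 'n) set" where
  "cube x L = {y. \<forall>i. \<bar>y $ i - x $ i\<bar> < L / 2}"

text \<open>A parabolic rectangle is determined by its center \<open>(x, t)\<close> and sidelength \<open>L > 0\<close>;
  its dilation by the factor \<open>\<lambda>\<close> is \<open>parabolic_rectangle p x t (\<lambda> * L)\<close>.\<close>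

definition parabolic_rectangle ::
    "real \<Rightarrow> real ^ 'n \<Rightarrow> real \<Rightarrow> real \<Rightarrow> ((real ^ 'n) \<times> real) set" where
  "parabolic_rectangle p x t L = cube x L \<times> {t - L powr p <..< t + L powr p}"

definition upper_quarter ::
    "real \<Rightarrow> real ^ 'n \<Rightarrow> real \<Rightarrow> real \<Rightarrow> ((real ^ 'n) \<times> real) set" where
  "upper_quarter p x t L =
     {(y, \<tau>) \<in> parabolic_rectangle p x t L. \<tau> > t + 1 / 2 * L powr p}"

definition lower_quarter ::
    "real \<Rightarrow> real ^ 'n \<Rightarrow> real \<Rightarrow> real \<Rightarrow> ((real ^ 'n) \<times> real) set" where
  "lower_quarter p x t L =
     {(y, \<tau>) \<in> parabolic_rectangle p x t L. \<tau> < t - 1 / 2 * L powr p}"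

definition locally_integrable_on :: "('a::euclidean_space \<Rightarrow> real) \<Rightarrow> 'a set \<Rightarrow> bool" where
  "locally_integrable_on u \<Omega> \<longleftrightarrow>
     (\<forall>K. compact K \<longrightarrow> K \<subseteq> \<Omega> \<longrightarrow> set_integrable lebesgue K u)"

text \<open>The mean over \<open>S\<close> of the positive part of \<open>f\<close>. It takes values in \<open>[0, \<infinity>]\<close>, since a locally
  integrable function need not be integrable over a rectangle that touches the boundary
  of the domain.\<close>

definition mean_pos_part :: "'a::euclidean_space set \<Rightarrow> ('a \<Rightarrow> real) \<Rightarrow> ennreal" where
  "mean_pos_part S f =
     (\<integral>\<^sup>+z\<in>S. ennreal (max (f z) 0) \<partial>lebesgue) / emeasure lebesgue S"

text \<open>The constants \<open>a\<^sub>R\<close> form a function of the center and the sidelength of \<open>R\<close>.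
  Functions on \<open>\<Omega>\<close> are total functions whose values outside \<open>\<Omega>\<close> play no role.\<close>

definition PBMO ::
    "real \<Rightarrow> real \<Rightarrow> ((real ^ 'n) \<times> real) set \<Rightarrow> ((real ^ 'n) \<times> real \<Rightarrow> real) set" where
  "PBMO p \<sigma> \<Omega> =
     {u. locally_integrable_on u \<Omega> \<and>
         (\<exists>a. (SUP (x, t, L) \<in> {(x, t, L). L > 0 \<and> parabolic_rectangle p x t (\<sigma> * L) \<subseteq> \<Omega>}.
                  mean_pos_part (upper_quarter p x t L) (\<lambda>z. u z - a x t L) +
                  mean_pos_part (lower_quarter p x t L) (\<lambda>z. a x t L - u z)) < \<infinity>)}"

end

theory Submission imports Defs begin

text \<open>
  The hypothesis controls \<open>u\<close> on rectangles \<open>R\<close> that keep a distance from the boundary of \<open>\<Omega>\<close>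
  proportional to their size, the conclusion on all rectangles inside \<open>\<Omega>\<close>. To a rectangle \<open>R\<close>
  that may touch the boundary, assign the constant of the concentric rectangle \<open>\<kappa>R\<close>
  with \<open>\<kappa> = 1 / (8 \<sigma>)\<close>; since \<open>\<sigma>\<kappa> < 1\<close>, the hypothesis applies to \<open>\<kappa>R\<close>.

  Chains. If the lower quarter of \<open>R\<^sub>1\<close> and the upper quarter of \<open>R\<^sub>2\<close> overlap in a fixed
  portion of both, then on the overlap \<open>a\<^sub>1 - a\<^sub>2 = (a\<^sub>1 - u) + (u - a\<^sub>2)\<close>, and
  averaging bounds \<open>a\<^sub>1 - a\<^sub>2\<close> from above (\<open>constants_compare_by_overlap\<close>). So constants are
  comparable along chains that run backwards in time. A rectangle of size \<open>\<delta>L\<close> near the upper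
  quarter of \<open>R\<close> is joined in this way to \<open>\<kappa>R\<close> by a chain of rectangles of the same size along a
  straight segment (\<open>constants_compare_to_center\<close>). The time difference is of order \<open>L\<^sup>p\<close>,
  which forces about \<open>\<delta>\<^sup>-\<^sup>p\<close> steps, whereas the spatial distance needs about \<open>\<delta>\<^sup>-\<^sup>1\<close> steps.
  Because \<open>p > 1\<close> the former number is the larger one when \<open>\<delta>\<close> is small.

  Self-improvement. Tile the upper quarter of \<open>R\<close> by upper quarters of rectangles of size
  \<open>L / N\<close> inside \<open>R\<close>. On a tile away from the boundary of \<open>R\<close> the hypothesis and a chain bound the
  mean of \<open>(u - a\<^sub>\<kappa>\<^sub>R)\<^sup>+\<close> by a constant. On a tile near the boundary, a chain bounds it by
  the same mean for the smaller rectangle plus a constant. For \<open>N\<close> large, the tiles near the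
  boundary fill at most half of the quarter, so a bound \<open>c\<close> valid for all rectangles in \<open>\<Omega>\<close>
  improves to \<open>D + c / 2\<close> with \<open>D\<close> fixed (\<open>truncated_bound_improves\<close>). An initial bound is
  obtained by truncating the integrand at height \<open>M\<close>; iterating gives the bound \<open>2 D + 1\<close>
  uniformly in \<open>M\<close>, and monotone convergence removes the truncation.

  Lower quarters are treated simultaneously: a sign \<open>s\<close> reverses both the time axis and the values
  of \<open>u\<close>.
\<close>

section \<open>Boxes in space-time\<close>

text \<open>Rectangles, their quarters, the tiles and the overlaps in a chain are all of this form, so that
  every inclusion between them reduces to one criterion on centers and sizes.\<close>

definition block :: "real ^ 'n \<Rightarrow> real \<Rightarrow> real \<Rightarrow> real \<Rightarrow> ((real ^ 'n) \<times> real) set" where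
  "block y r \<tau> h = {(z, \<theta>). (\<forall>i. \<bar>z $ i - y $ i\<bar> < r / 2) \<and> \<bar>\<theta> - \<tau>\<bar> < h}"

definition closed_block :: "real ^ 'n \<Rightarrow> real \<Rightarrow> real \<Rightarrow> real \<Rightarrow> ((real ^ 'n) \<times> real) set" where
  "closed_block y r \<tau> h = {(z, \<theta>). (\<forall>i. \<bar>z $ i - y $ i\<bar> \<le> r / 2) \<and> \<bar>\<theta> - \<tau>\<bar> \<le> h}"

lemma parabolic_rectangle_eq_block: "parabolic_rectangle p x t L = block x L t (L powr p)"
  by (auto simp: parabolic_rectangle_def cube_def block_def abs_less_iff algebra_simps)

lemma block_subset_block:
  assumes "\<And>i. \<bar>y $ i - y' $ i\<bar> + r / 2 \<le> r' / 2" and "\<bar>\<tau> - \<tau>'\<bar> + h \<le> h'"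
  shows "block y r \<tau> h \<subseteq> block y' r' \<tau>' h'"
proof -
  have "\<bar>z $ i - y' $ i\<bar> < r' / 2" if "\<bar>z $ i - y $ i\<bar> < r / 2" for z i
    using assms(1)[of i] that by linarith
  moreover have "\<bar>\<theta> - \<tau>'\<bar> < h'" if "\<bar>\<theta> - \<tau>\<bar> < h" for \<theta>
    using assms(2) that by linarith
  ultimately show ?thesis by (auto simp: block_def)
qed

lemma parabolic_rectangle_subset:
  assumes "parabolic_rectangle p x t L \<subseteq> \<Omega>"
    and "\<And>i. \<bar>y $ i - x $ i\<bar> + l / 2 \<le> L / 2" and "\<bar>t' - t\<bar> + l powr p \<le> L powr p"
  shows "parabolic_rectangle p y t' l \<subseteq> \<Omega>"
  using block_subset_block[OF assms(2,3)] assms(1)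
  unfolding parabolic_rectangle_eq_block by (rule order_trans)

lemma closed_block_eq_cbox:
  "closed_block y r \<tau> h = cbox (y - (\<chi> i. r / 2), \<tau> - h) (y + (\<chi> i. r / 2), \<tau> + h)"
proof -
  have *: "(\<forall>i. \<bar>z $ i - y $ i\<bar> \<le> r / 2) \<longleftrightarrow> z \<in> cbox (y - (\<chi> i. r / 2)) (y + (\<chi> i. r / 2))" for z
  proof -
    have "\<bar>z $ i - y $ i\<bar> \<le> r / 2 \<longleftrightarrow> y $ i - r / 2 \<le> z $ i \<and> z $ i \<le> y $ i + r / 2" for i
      by linarith
    then show ?thesis by (simp add: mem_box_cart)
  qed
  show ?thesis
    unfolding cbox_Pair_eq closed_block_def using *
    by (auto simp: abs_le_iff algebra_simps)
qed

lemma block_eq_box: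
  "block y r \<tau> h = box (y - (\<chi> i. r / 2), \<tau> - h) (y + (\<chi> i. r / 2), \<tau> + h)"
proof -
  have *: "(\<forall>i. \<bar>z $ i - y $ i\<bar> < r / 2) \<longleftrightarrow> z \<in> box (y - (\<chi> i. r / 2)) (y + (\<chi> i. r / 2))" for z
  proof -
    have "\<bar>z $ i - y $ i\<bar> < r / 2 \<longleftrightarrow> y $ i - r / 2 < z $ i \<and> z $ i < y $ i + r / 2" for i
      by linarith
    then show ?thesis by (simp add: mem_box_cart)
  qed
  show ?thesis
    unfolding box_prod block_def using *
    by (auto simp: abs_less_iff algebra_simps)
qed

lemma sets_block [measurable]: "block y r \<tau> h \<in> sets lebesgue"
  by (simp add: block_eq_box)

lemma sets_closed_block [measurable]: "closed_block y r \<tau> h \<in> sets lebesgue"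
  by (simp add: closed_block_eq_cbox)

lemma emeasure_block:
  fixes y :: "real ^ 'n"
  assumes "0 < r" and "0 < h"
  shows "emeasure lebesgue (block y r \<tau> h) = ennreal (r ^ CARD('n) * (2 * h))"
proof -
  have "block y r \<tau> h = box (y - (\<chi> i. r / 2)) (y + (\<chi> i. r / 2)) \<times> box (\<tau> - h) (\<tau> + h)"
    by (simp add: block_eq_box box_prod)
  moreover have "emeasure lborel (box (y - (\<chi> i. r / 2)) (y + (\<chi> i. r / 2))) = ennreal (r ^ CARD('n))"
    using assms by (subst emeasure_lborel_box)
      (auto simp: Basis_vec_def inner_axis prod.UNION_disjoint axis_eq_axis)
  ultimately show ?thesis
    using assms by (simp add: lborel_prod[symmetric] lborel.emeasure_pair_measure_Times ennreal_mult)
qed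

text \<open>Open boxes cannot tile an open box; this lets closed boxes be used for the covering.\<close>

lemma nn_integral_closed_block:
  "(\<integral>\<^sup>+z\<in>closed_block y r \<tau> h. f z \<partial>lebesgue) = (\<integral>\<^sup>+z\<in>block y r \<tau> h. f z \<partial>lebesgue)"
proof -
  have "negligible (closed_block y r \<tau> h - block y r \<tau> h)"
    by (simp add: closed_block_eq_cbox block_eq_box negligible_frontier_interval)
  then have "AE z in lebesgue. z \<notin> closed_block y r \<tau> h - block y r \<tau> h"
    unfolding negligible_iff_null_sets by (rule AE_not_in)
  moreover have "block y r \<tau> h \<subseteq> closed_block y r \<tau> h"
    by (auto simp: block_def closed_block_def intro: less_imp_le)
  ultimately show ?thesis
    by (intro nn_integral_cong_AE) (auto simp: indicator_def elim!: eventually_mono)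
qed

section \<open>Auxiliary facts on integrals\<close>

lemma nn_integral_finite_cover:
  fixes f :: "'a \<Rightarrow> ennreal"
  assumes "finite I" and "A \<subseteq> (\<Union>i\<in>I. C i)" and "f \<in> borel_measurable M"
    and "\<And>i. i \<in> I \<Longrightarrow> C i \<in> sets M"
  shows "(\<integral>\<^sup>+z\<in>A. f z \<partial>M) \<le> (\<Sum>i\<in>I. \<integral>\<^sup>+z\<in>C i. f z \<partial>M)"
proof -
  have "f z * indicator A z \<le> (\<Sum>i\<in>I. f z * indicator (C i) z)" for z
  proof (cases "z \<in> A")
    case True
    then obtain i where "i \<in> I" "z \<in> C i" using assms(2) by auto
    then have "f z * indicator A z \<le> f z * indicator (C i) z" by (simp add: indicator_def)
    also have "\<dots> \<le> (\<Sum>i\<in>I. f z * indicator (C i) z)"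
      using assms(1) \<open>i \<in> I\<close> by (intro member_le_sum) auto
    finally show ?thesis .
  qed simp
  then have "(\<integral>\<^sup>+z\<in>A. f z \<partial>M) \<le> (\<integral>\<^sup>+z. (\<Sum>i\<in>I. f z * indicator (C i) z) \<partial>M)"
    by (intro nn_integral_mono)
  also have "\<dots> = (\<Sum>i\<in>I. \<integral>\<^sup>+z\<in>C i. f z \<partial>M)"
    using assms by (intro nn_integral_sum) auto
  finally show ?thesis .
qed

text \<open>An open set is a countable union of compact boxes, and integrability on each of them gives
  measurability there.\<close>

lemma locally_integrable_measurable:
  fixes u :: "'a::euclidean_space \<Rightarrow> real"
  assumes "locally_integrable_on u \<Omega>" and "open \<Omega>"
  shows "(\<lambda>z. indicator \<Omega> z * u z) \<in> borel_measurable lebesgue"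
proof -
  obtain D where D: "countable D" "D \<subseteq> Pow \<Omega>" "\<And>X. X \<in> D \<Longrightarrow> \<exists>a b. X = cbox a b" "\<Union>D = \<Omega>"
    using open_countable_Union_open_cbox[OF assms(2)] by metis
  show ?thesis
  proof (rule measurable_piecewise_restrict[of "insert (- \<Omega>) D"])
    show "countable (insert (- \<Omega>) D)" using D by simp
    show "space lebesgue \<subseteq> \<Union>(insert (- \<Omega>) D)" using D by auto
    fix X assume X: "X \<in> insert (- \<Omega>) D"
    have "X \<in> sets lebesgue \<and> (\<lambda>z. indicator X z * (indicator \<Omega> z * u z)) \<in> borel_measurable lebesgue"
    proof (cases "X = - \<Omega>")
      case True
      then have "(\<lambda>z. indicator X z * (indicator \<Omega> z * u z)) = (\<lambda>z. 0)"
        by (auto simp: indicator_def)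
      then show ?thesis using True assms(2)
        by (simp add: lebesgue_openin Compl_in_sets_lebesgue)
    next
      case False
      then have XD: "X \<in> D" using X by simp
      then obtain a b where ab: "X = cbox a b" using D(3) by blast
      have "X \<subseteq> \<Omega>" using XD D(2) by auto
      then have "set_integrable lebesgue X u"
        using assms(1) ab by (auto simp: locally_integrable_on_def)
      then have "(\<lambda>z. indicator X z * u z) \<in> borel_measurable lebesgue"
        unfolding set_integrable_def by auto
      moreover have "(\<lambda>z. indicator X z * (indicator \<Omega> z * u z)) = (\<lambda>z. indicator X z * u z)"
        using \<open>X \<subseteq> \<Omega>\<close> by (auto simp: indicator_def fun_eq_iff)
      ultimately show ?thesis using ab by simp
    qed
    then show "X \<inter> space lebesgue \<in> sets lebesgue"
      "(\<lambda>z. indicator \<Omega> z * u z) \<in> borel_measurable (restrict_space lebesgue X)"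
      by (simp_all add: borel_measurable_restrict_space_iff mult.commute mult.assoc)
  qed
qed

lemma set_nn_integral_le_add_const:
  assumes "\<And>z. f z \<le> g z + ennreal C" and "g \<in> borel_measurable M" and "Q \<in> sets M"
    and "(\<integral>\<^sup>+z\<in>Q. g z \<partial>M) \<le> ennreal (b * V)" and "emeasure M Q = ennreal V"
    and "0 \<le> b" "0 \<le> C" "0 \<le> V"
  shows "(\<integral>\<^sup>+z\<in>Q. f z \<partial>M) \<le> ennreal ((b + C) * V)"
proof -
  have "(\<integral>\<^sup>+z\<in>Q. f z \<partial>M) \<le> (\<integral>\<^sup>+z\<in>Q. (g z + ennreal C) \<partial>M)"
    by (intro nn_integral_mono mult_right_mono assms) auto
  also have "\<dots> = (\<integral>\<^sup>+z\<in>Q. g z \<partial>M) + (\<integral>\<^sup>+z\<in>Q. ennreal C \<partial>M)"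
    using assms by (intro nn_set_integral_add) auto
  also have "\<dots> \<le> ennreal (b * V) + ennreal C * ennreal V"
    using assms by (intro add_mono) (auto simp: nn_integral_cmult_indicator)
  also have "\<dots> = ennreal ((b + C) * V)"
    using assms by (simp add: ennreal_mult[symmetric] ennreal_plus[symmetric] algebra_simps del: ennreal_plus)
  finally show ?thesis .
qed

lemma min_le_min_plus:
  fixes e1 e2 M C :: ennreal
  assumes "e1 \<le> e2 + C"
  shows "min e1 M \<le> min e2 M + C"
proof (cases "e2 \<le> M")
  case True
  then show ?thesis using assms by (simp add: min.coboundedI1 min_absorb1)
next
  case False
  then show ?thesis by (simp add: min_def add_increasing2)
qed

section \<open>Quarters and one-sided deviations\<close>

text \<open>The sign \<open>s = 1\<close> gives the upper quarter and \<open>s = -1\<close> the lower one, as a box around the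
  midpoint of its time interval.\<close>

definition quarter ::
    "real \<Rightarrow> real \<Rightarrow> real ^ 'n \<Rightarrow> real \<Rightarrow> real \<Rightarrow> ((real ^ 'n) \<times> real) set" where
  "quarter p s x t L = block x L (t + s * (3 / 4 * L powr p)) (L powr p / 4)"

definition excess :: "('a \<Rightarrow> real) \<Rightarrow> real \<Rightarrow> real \<Rightarrow> 'a \<Rightarrow> ennreal" where
  "excess v s c z = ennreal (max (s * (v z - c)) 0)"

lemma upper_quarter_eq_quarter: "upper_quarter p x t L = quarter p 1 x t L"
proof -
  have "\<bar>\<theta> - t\<bar> < L powr p \<and> t + 1 / 2 * L powr p < \<theta>
      \<longleftrightarrow> \<bar>\<theta> - (t + 1 * (3 / 4 * L powr p))\<bar> < L powr p / 4" for \<theta>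
    using powr_ge_zero[of L p] by linarith
  then show ?thesis
    unfolding upper_quarter_def quarter_def parabolic_rectangle_eq_block block_def by blast
qed

lemma lower_quarter_eq_quarter: "lower_quarter p x t L = quarter p (-1) x t L"
proof -
  have "\<bar>\<theta> - t\<bar> < L powr p \<and> \<theta> < t - 1 / 2 * L powr p
      \<longleftrightarrow> \<bar>\<theta> - (t + (-1) * (3 / 4 * L powr p))\<bar> < L powr p / 4" for \<theta>
    using powr_ge_zero[of L p] by linarith
  then show ?thesis
    unfolding lower_quarter_def quarter_def parabolic_rectangle_eq_block block_def by blast
qed

lemma sets_quarter [measurable]: "quarter p s x t L \<in> sets lebesgue"
  by (simp add: quarter_def)

lemma emeasure_quarter:
  fixes x :: "real ^ 'n"
  assumes "0 < L"
  shows "emeasure lebesgue (quarter p s x t L) = ennreal (L ^ CARD('n) * (L powr p / 2))"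
  unfolding quarter_def using assms by (subst emeasure_block) simp_all

lemma measurable_excess [measurable (raw)]:
  assumes [measurable]: "v \<in> borel_measurable M"
  shows "excess v s c \<in> borel_measurable M"
  unfolding excess_def[abs_def] by measurable

lemma excess_le_excess_plus:
  assumes "s * (c' - c) \<le> C" and "0 \<le> C"
  shows "excess v s c z \<le> excess v s c' z + ennreal C"
proof -
  have "s * (v z - c) = s * (v z - c') + s * (c' - c)" by (simp add: algebra_simps)
  then have "max (s * (v z - c)) 0 \<le> max (s * (v z - c')) 0 + C" using assms by linarith
  then show ?thesis using assms(2) by (simp add: excess_def flip: ennreal_plus)
qed

section \<open>Tiling a quarter by smaller quarters\<close>

definition subcube_center :: "real ^ 'n \<Rightarrow> real \<Rightarrow> nat \<Rightarrow> ('n \<Rightarrow> nat) \<Rightarrow> real ^ 'n" where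
  "subcube_center x L N i = (\<chi> c. x $ c - L / 2 + (real (i c) + 1 / 2) * (L / real N))"

text \<open>The spatial cube is cut into \<open>N\<^sup>n\<close> cubes. In time, the tiles have height
  \<open>h = (L / N)\<^sup>p / 2\<close>, and since \<open>N\<^sup>p\<close> need not be an integer they are stacked from the outer
  end of the quarter towards the center of the rectangle, the last one possibly sticking out of
  the quarter. Stacking from the outer end keeps all the small rectangles inside the large one.
  Row \<open>j\<close> covers the time offsets between \<open>L\<^sup>p - (j + 1) h\<close> and \<open>L\<^sup>p - j h\<close>, so its rectangle is
  centered at the offset \<open>L\<^sup>p - (j + 2) h\<close>.\<close>

lemma quarter_subset_tiles:
  fixes x :: "real ^ 'n"
  assumes s: "s = 1 \<or> s = -1" and L: "0 < L" and N: "0 < N" "real N powr p \<le> real K"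
  shows "quarter p s x t L \<subseteq> (\<Union>(i, j) \<in> {i. \<forall>c. i c < N} \<times> {..<K}.
    closed_block (subcube_center x L N i) (L / real N)
      (t + s * (L powr p - (real j + 2) * ((L / real N) powr p / 2)) + s * (3 / 4 * (L / real N) powr p))
      ((L / real N) powr p / 4))"
proof
  fix z assume z: "z \<in> quarter p s x t L"
  obtain y \<theta> where yz: "z = (y, \<theta>)" by (cases z)
  define l where "l = L / real N"
  define h where "h = l powr p / 2"
  have l: "0 < l" "l * real N = L" and h: "0 < h" using L N by (auto simp: l_def h_def)
  have hL: "L powr p / 2 = real N powr p * h"
    using l by (simp add: h_def powr_mult[symmetric] flip: l(2)) (simp add: powr_mult mult.commute)
  define \<eta> where "\<eta> = (\<lambda>c. (y $ c - x $ c + L / 2) / l)"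
  define i where "i = (\<lambda>c. nat \<lfloor>\<eta> c\<rfloor>)"
  have y: "\<bar>y $ c - x $ c\<bar> < L / 2" for c using z by (auto simp: yz quarter_def block_def)
  have eta: "0 \<le> \<eta> c" "\<eta> c < real N" for c
  proof -
    have "0 \<le> y $ c - x $ c + L / 2" using y[of c] by linarith
    moreover have "y $ c - x $ c + L / 2 < l * real N" using y[of c] unfolding l(2) by linarith
    ultimately show "0 \<le> \<eta> c" "\<eta> c < real N"
      using l(1) unfolding \<eta>_def by (simp_all add: pos_divide_less_eq mult.commute)
  qed
  have i: "real (i c) \<le> \<eta> c" "\<eta> c < real (i c) + 1" for c
    using eta(1)[of c] unfolding i_def by linarith+
  have iN: "i c < N" for c using i(1)[of c] eta(2)[of c] by linarith
  have space: "\<bar>y $ c - subcube_center x L N i $ c\<bar> \<le> l / 2" for c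
  proof -
    have "y $ c - subcube_center x L N i $ c = (\<eta> c - (real (i c) + 1 / 2)) * l"
    proof -
      have "\<eta> c * l = y $ c - x $ c + L / 2" using l(1) by (simp add: \<eta>_def)
      then show ?thesis unfolding subcube_center_def l_def[symmetric] by (simp add: left_diff_distrib)
    qed
    moreover have "\<bar>\<eta> c - (real (i c) + 1 / 2)\<bar> \<le> 1 / 2" using i[of c] by linarith
    ultimately show ?thesis using l mult_right_mono[of _ "1/2" l] by (simp add: abs_mult)
  qed
  define r where "r = s * (\<theta> - t)"
  have ss: "s * s = 1" using s by auto
  have th: "\<theta> = t + s * r" unfolding r_def using ss by (simp flip: mult.assoc)
  have "\<bar>\<theta> - (t + s * (3 / 4 * L powr p))\<bar> < L powr p / 4"
    using z by (auto simp: yz quarter_def block_def)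
  then have "\<bar>r - 3 / 4 * L powr p\<bar> < L powr p / 4" using s by (auto simp: th abs_minus_commute)
  then have r: "L powr p / 2 < r \<and> r < L powr p" by linarith
  define \<zeta> where "\<zeta> = (L powr p - r) / h"
  define j where "j = nat \<lfloor>\<zeta>\<rfloor>"
  have zeta: "0 \<le> \<zeta>" "\<zeta> < real N powr p"
    using r h hL unfolding \<zeta>_def by (auto simp: field_simps)
  have j: "real j \<le> \<zeta>" "\<zeta> < real j + 1" using zeta(1) unfolding j_def by linarith+
  have jK: "j < K" using j(1) zeta(2) N(2) by linarith
  have time: "\<bar>\<theta> - (t + s * (L powr p - (real j + 2) * (l powr p / 2)) + s * (3 / 4 * l powr p))\<bar> \<le> l powr p / 4"
  proof -
    have "\<theta> - (t + s * (L powr p - (real j + 2) * (l powr p / 2)) + s * (3 / 4 * l powr p))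
        = s * ((real j + 1 / 2 - \<zeta>) * h)"
      using h by (simp add: th \<zeta>_def h_def field_simps)
    moreover have "\<bar>real j + 1 / 2 - \<zeta>\<bar> \<le> 1 / 2" using j by linarith
    then have "\<bar>(real j + 1 / 2 - \<zeta>) * h\<bar> \<le> 1 / 2 * h"
      using h unfolding abs_mult by (intro mult_mono) auto
    moreover have "\<bar>s * w\<bar> = \<bar>w\<bar>" for w using s by auto
    ultimately show ?thesis by (simp only: h_def)
  qed
  show "z \<in> (\<Union>(i, j) \<in> {i. \<forall>c. i c < N} \<times> {..<K}.
    closed_block (subcube_center x L N i) (L / real N)
      (t + s * (L powr p - (real j + 2) * ((L / real N) powr p / 2)) + s * (3 / 4 * (L / real N) powr p))
      ((L / real N) powr p / 4))"
    using iN jK space time unfolding yz l_def[symmetric] closed_block_def by blast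
qed

lemma card_functions_into:
  fixes A :: "nat set"
  assumes "finite A"
  shows "finite {i :: 'n::finite \<Rightarrow> nat. \<forall>c. i c \<in> A}"
    and "card {i :: 'n::finite \<Rightarrow> nat. \<forall>c. i c \<in> A} = card A ^ CARD('n)"
proof -
  have eq: "{i :: 'n \<Rightarrow> nat. \<forall>c. i c \<in> A} = PiE UNIV (\<lambda>_. A)" by (auto simp: PiE_def)
  show "finite {i :: 'n \<Rightarrow> nat. \<forall>c. i c \<in> A}" unfolding eq using assms by (intro finite_PiE) auto
  show "card {i :: 'n \<Rightarrow> nat. \<forall>c. i c \<in> A} = card A ^ CARD('n)" unfolding eq by (simp add: card_PiE)
qed

text \<open>Tiles closer to the boundary than \<open>m\<close> tiles are the bad ones. With \<open>m\<close> fixed and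
  \<open>N \<rightarrow> \<infinity>\<close>, their proportion and the relative overshoot \<open>K / N\<^sup>p - 1\<close> of the covering both
  tend to zero; this is the last inequality. The lower bounds on \<open>N\<close> make chains
  of rectangles of relative size at most \<open>1 / N\<close> possible.\<close>

lemma ex_fine_grid:
  fixes p \<sigma> :: real and n :: nat
  assumes p: "p > 1" and \<sigma>: "\<sigma> > 1"
  obtains N m K :: nat where "2 * \<sigma> powr p \<le> real m" "2 * m \<le> N" "m \<le> K" "120 \<le> N"
    "8 * \<sigma> \<le> real N" "(1 / real N) powr (p - 1) \<le> 1 / 24"
    "real N powr p \<le> real K" "real K \<le> real N powr p + 1"
    "real (N ^ n * K) - real ((N - 2 * m) ^ n * (K - m)) \<le> 1 / 2 * (real N ^ n * real N powr p)"
proof -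
  define m where "m = nat \<lceil>2 * \<sigma> powr p\<rceil>"
  have m: "2 * \<sigma> powr p \<le> real m" unfolding m_def by linarith
  have pw: "((\<lambda>N. real N powr -p) \<longlongrightarrow> 0) sequentially"
    using p by (intro tendsto_neg_powr filterlim_real_sequentially) auto
  have "((\<lambda>N. real N powr -(p - 1)) \<longlongrightarrow> 0) sequentially"
    using p by (intro tendsto_neg_powr filterlim_real_sequentially) auto
  then have e1: "eventually (\<lambda>N. real N powr -(p - 1) < 1 / 24) sequentially"
    by (rule order_tendstoD) simp
  have "((\<lambda>N. 1 + real N powr -p - (1 - real (2 * m) * (1 / real N)) ^ n * (1 - real m * real N powr -p))
      \<longlongrightarrow> 1 + 0 - (1 - real (2 * m) * 0) ^ n * (1 - real m * 0)) sequentially"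
    by (intro tendsto_intros pw lim_1_over_n)
  then have e2: "eventually (\<lambda>N. 1 + real N powr -p
      - (1 - real (2 * m) * (1 / real N)) ^ n * (1 - real m * real N powr -p) < 1 / 2) sequentially"
    by (rule order_tendstoD) simp
  have e3: "eventually (\<lambda>N. max (max 120 (2 * m)) (nat \<lceil>8 * \<sigma>\<rceil>) \<le> N) sequentially"
    by (rule eventually_ge_at_top)
  from eventually_happens[OF eventually_conj[OF e1 eventually_conj[OF e2 e3]]]
  obtain N where N: "real N powr -(p - 1) < 1 / 24"
     "1 + real N powr -p - (1 - real (2 * m) * (1 / real N)) ^ n * (1 - real m * real N powr -p) < 1 / 2"
     "120 \<le> N" "2 * m \<le> N" "nat \<lceil>8 * \<sigma>\<rceil> \<le> N" by auto
  define K where "K = nat \<lceil>real N powr p\<rceil>"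
  have K: "real N powr p \<le> real K" "real K \<le> real N powr p + 1"
    unfolding K_def using powr_ge_zero[of "real N" p] by linarith+
  have "real N powr 1 \<le> real N powr p" using N(3) p by (intro powr_mono) auto
  then have "real N \<le> real K" using K(1) N(3) by simp
  then have mK: "m \<le> K" using N(4) by linarith
  have N0: "0 < real N" using N(3) by simp
  define W where "W = real N ^ n * real N powr p"
  have W: "0 < W" using N0 by (simp add: W_def)
  have "real (N ^ n * K) \<le> real N ^ n * (real N powr p + 1)"
    using K(2) by (simp add: mult_left_mono)
  also have "\<dots> = W * (1 + real N powr -p)"
    using N0 by (simp add: W_def powr_minus field_simps)
  finally have 1: "real (N ^ n * K) \<le> W * (1 + real N powr -p)" .
  have "W * ((1 - real (2 * m) * (1 / real N)) ^ n * (1 - real m * real N powr -p))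
     = (real N * (1 - real (2 * m) * (1 / real N))) ^ n * (real N powr p * (1 - real m * real N powr -p))"
    by (simp add: W_def power_mult_distrib)
  also have "real N * (1 - real (2 * m) * (1 / real N)) = real (N - 2 * m)"
    using N(4) N0 by (simp add: of_nat_diff field_simps)
  also have "real N powr p * (1 - real m * real N powr -p) = real N powr p - real m"
    using N0 by (simp add: powr_minus field_simps)
  also have "real (N - 2 * m) ^ n * (real N powr p - real m) \<le> real (N - 2 * m) ^ n * real (K - m)"
    using K(1) mK by (intro mult_left_mono) (auto simp: of_nat_diff)
  finally have "W * ((1 - real (2 * m) * (1 / real N)) ^ n * (1 - real m * real N powr -p))
     \<le> real ((N - 2 * m) ^ n * (K - m))" by simp
  then have "real (N ^ n * K) - real ((N - 2 * m) ^ n * (K - m))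
     \<le> W * (1 + real N powr -p - (1 - real (2 * m) * (1 / real N)) ^ n * (1 - real m * real N powr -p))"
    using 1 by (simp add: algebra_simps)
  also have "\<dots> \<le> W * (1 / 2)" using N(2) W by (intro mult_left_mono) auto
  finally have "real (N ^ n * K) - real ((N - 2 * m) ^ n * (K - m)) \<le> 1 / 2 * W" by simp
  moreover have "(1 / real N) powr (p - 1) \<le> 1 / 24"
  proof -
    have "(1 / real N) powr (p - 1) = real N powr -(p - 1)"
      using N0 by (subst powr_minus_divide) (simp add: powr_divide)
    then show ?thesis using N(1) by linarith
  qed
  moreover have "8 * \<sigma> \<le> real N" using N(5) by linarith
  ultimately show ?thesis by (intro that[OF m N(4) mK N(3) _ _ K]) (simp_all only: W_def)
qed

section \<open>Comparing the constants of two rectangles\<close>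

text \<open>The hypothesis on \<open>u\<close>, with \<open>v\<close> a globally measurable function that agrees with \<open>u\<close>
  on \<open>\<Omega>\<close>.\<close>

locale interior_oscillation_bound =
  fixes p \<sigma> B :: real
    and \<Omega> :: "((real ^ 'n) \<times> real) set"
    and v :: "(real ^ 'n) \<times> real \<Rightarrow> real"
    and a :: "real ^ 'n \<Rightarrow> real \<Rightarrow> real \<Rightarrow> real"
  assumes p_gt_1: "p > 1" and sigma_gt_1: "\<sigma> > 1" and B_nonneg: "B \<ge> 0"
    and v_measurable [measurable]: "v \<in> borel_measurable lebesgue"
    and bound: "\<lbrakk>s = 1 \<or> s = -1; 0 < L; parabolic_rectangle p x t (\<sigma> * L) \<subseteq> \<Omega>\<rbrakk> \<Longrightarrow>
      (\<integral>\<^sup>+z\<in>quarter p s x t L. excess v s (a x t L) z \<partial>lebesgue)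
        \<le> ennreal (B * (L ^ CARD('n) * (L powr p / 2)))"
begin

text \<open>On the overlap \<open>U\<close>, \<open>s (a\<^sub>1 - a\<^sub>2)\<close> is the sum of \<open>s (a\<^sub>1 - v)\<close> and \<open>s (v - a\<^sub>2)\<close>, whose positive
  parts have integrals over \<open>U\<close> of at most \<open>B\<close> times the measures of the two quarters.\<close>

lemma constants_compare_by_overlap:
  assumes s: "s = 1 \<or> s = -1" and L: "0 < L1" "0 < L2"
    and R: "parabolic_rectangle p x1 t1 (\<sigma> * L1) \<subseteq> \<Omega>" "parabolic_rectangle p x2 t2 (\<sigma> * L2) \<subseteq> \<Omega>"
    and U: "U \<in> sets lebesgue" "U \<subseteq> quarter p (-s) x1 t1 L1" "U \<subseteq> quarter p s x2 t2 L2"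
    and m: "emeasure lebesgue U = ennreal m" "0 < m"
    and K: "L1 ^ CARD('n) * (L1 powr p / 2) \<le> K * m" "L2 ^ CARD('n) * (L2 powr p / 2) \<le> K * m"
  shows "s * (a x1 t1 L1 - a x2 t2 L2) \<le> 2 * K * B"
proof -
  let ?d = "s * (a x1 t1 L1 - a x2 t2 L2)"
  let ?V1 = "L1 ^ CARD('n) * (L1 powr p / 2)" and ?V2 = "L2 ^ CARD('n) * (L2 powr p / 2)"
  have pw: "ennreal ?d \<le> excess v (-s) (a x1 t1 L1) z + excess v s (a x2 t2 L2) z" for z
  proof -
    have "?d = - s * (v z - a x1 t1 L1) + s * (v z - a x2 t2 L2)" by (simp add: algebra_simps)
    then have "?d \<le> max (- s * (v z - a x1 t1 L1)) 0 + max (s * (v z - a x2 t2 L2)) 0" by linarith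
    then show ?thesis unfolding excess_def by (simp flip: ennreal_plus add: ennreal_leI)
  qed
  have "ennreal ?d * ennreal m = (\<integral>\<^sup>+z\<in>U. ennreal ?d \<partial>lebesgue)"
    using U m by (simp add: nn_integral_cmult_indicator)
  also have "\<dots> \<le> (\<integral>\<^sup>+z\<in>U. (excess v (-s) (a x1 t1 L1) z + excess v s (a x2 t2 L2) z) \<partial>lebesgue)"
    using pw by (intro nn_integral_mono mult_right_mono) auto
  also have "\<dots> = (\<integral>\<^sup>+z\<in>U. excess v (-s) (a x1 t1 L1) z \<partial>lebesgue)
      + (\<integral>\<^sup>+z\<in>U. excess v s (a x2 t2 L2) z \<partial>lebesgue)"
    using U(1) by (intro nn_set_integral_add) measurable
  also have "\<dots> \<le> (\<integral>\<^sup>+z\<in>quarter p (-s) x1 t1 L1. excess v (-s) (a x1 t1 L1) z \<partial>lebesgue)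
      + (\<integral>\<^sup>+z\<in>quarter p s x2 t2 L2. excess v s (a x2 t2 L2) z \<partial>lebesgue)"
    by (intro add_mono nn_set_integral_set_mono U)
  also have "\<dots> \<le> ennreal (B * ?V1) + ennreal (B * ?V2)"
    using s by (intro add_mono bound L R) auto
  also have "\<dots> = ennreal (B * ?V1 + B * ?V2)"
    using L B_nonneg by (simp add: ennreal_plus)
  also have "\<dots> \<le> ennreal (2 * K * B * m)"
    using mult_left_mono[OF K(1) B_nonneg] mult_left_mono[OF K(2) B_nonneg]
    by (intro ennreal_leI) (simp add: algebra_simps)
  finally have *: "ennreal ?d * ennreal m \<le> ennreal (2 * K * B * m)" .
  have "0 \<le> K * m" using K(1) L(1) by (smt (verit) zero_le_power powr_ge_zero mult_nonneg_nonneg divide_nonneg_pos)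
  then have "0 \<le> K" using m(2) by (simp add: zero_le_mult_iff)
  show ?thesis
  proof (cases "?d \<le> 0")
    case True
    then show ?thesis using \<open>0 \<le> K\<close> B_nonneg by (smt (verit) mult_nonneg_nonneg)
  next
    case False
    then have "?d * m \<le> 2 * K * B * m"
      using * m(2) \<open>0 \<le> K\<close> B_nonneg by (simp flip: ennreal_mult)
    then show ?thesis using m(2) by simp
  qed
qed

text \<open>Two rectangles of size \<open>l\<close> whose time difference is near \<open>3/2 l\<^sup>p\<close>, the distance of
  the midpoints of the two quarters of one rectangle: the opposite quarters then overlap in a box
  around the midpoint of the two centers.\<close>

lemma constants_compare_one_step:
  assumes s: "s = 1 \<or> s = -1" and l: "0 < l"
    and R: "parabolic_rectangle p x1 t1 (\<sigma> * l) \<subseteq> \<Omega>" "parabolic_rectangle p x2 t2 (\<sigma> * l) \<subseteq> \<Omega>"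
    and x: "\<And>i. \<bar>x1 $ i - x2 $ i\<bar> \<le> l / 2"
    and t: "t1 - t2 = s * d" "5 / 4 * l powr p \<le> d" "d \<le> 3 / 2 * l powr p"
  shows "s * (a x1 t1 l - a x2 t2 l) \<le> 2 ^ (CARD('n) + 2) * B"
proof -
  let ?y = "\<chi> i. (x1 $ i + x2 $ i) / 2" and ?m = "(t1 + t2) / 2"
  define U where "U = block ?y (l / 2) ?m (l powr p / 8)"
  have lp: "0 < l powr p" using l by simp
  have x': "\<bar>(x1 $ i + x2 $ i) / 2 - x1 $ i\<bar> + (l / 2) / 2 \<le> l / 2"
    "\<bar>(x1 $ i + x2 $ i) / 2 - x2 $ i\<bar> + (l / 2) / 2 \<le> l / 2" for i
    using x[of i] by (simp_all add: field_simps abs_minus_commute)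
  have t': "\<bar>?m - (t1 + - s * (3 / 4 * l powr p))\<bar> + l powr p / 8 \<le> l powr p / 4"
    "\<bar>?m - (t2 + s * (3 / 4 * l powr p))\<bar> + l powr p / 8 \<le> l powr p / 4"
  proof -
    have "t1 = t2 + s * d" using t(1) by simp
    then have e: "?m - (t1 + - s * (3 / 4 * l powr p)) = s * (3 / 4 * l powr p - d / 2)"
      "?m - (t2 + s * (3 / 4 * l powr p)) = - s * (3 / 4 * l powr p - d / 2)"
      by (simp_all add: field_simps)
    have "\<bar>3 / 4 * l powr p - d / 2\<bar> + l powr p / 8 \<le> l powr p / 4" using t(2,3) by linarith
    then show "\<bar>?m - (t1 + - s * (3 / 4 * l powr p))\<bar> + l powr p / 8 \<le> l powr p / 4"
      "\<bar>?m - (t2 + s * (3 / 4 * l powr p))\<bar> + l powr p / 8 \<le> l powr p / 4"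
      unfolding e using s by (auto simp: abs_mult)
  qed
  have "s * (a x1 t1 l - a x2 t2 l) \<le> 2 * 2 ^ (CARD('n) + 1) * B"
  proof (rule constants_compare_by_overlap[OF s l l R])
    show "U \<in> sets lebesgue" by (simp add: U_def)
    show "U \<subseteq> quarter p (-s) x1 t1 l" unfolding U_def quarter_def
      using x'(1) t'(1) by (intro block_subset_block) auto
    show "U \<subseteq> quarter p s x2 t2 l" unfolding U_def quarter_def
      using x'(2) t'(2) by (intro block_subset_block) auto
    show "emeasure lebesgue U = ennreal ((l / 2) ^ CARD('n) * (2 * (l powr p / 8)))"
      unfolding U_def using l lp by (intro emeasure_block) auto
    show "0 < (l / 2) ^ CARD('n) * (2 * (l powr p / 8))" using l lp by simp
    show "l ^ CARD('n) * (l powr p / 2)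
        \<le> 2 ^ (CARD('n) + 1) * ((l / 2) ^ CARD('n) * (2 * (l powr p / 8)))"
      using l by (simp add: power_divide field_simps)
    then show "l ^ CARD('n) * (l powr p / 2)
        \<le> 2 ^ (CARD('n) + 1) * ((l / 2) ^ CARD('n) * (2 * (l powr p / 8)))" .
  qed
  then show ?thesis by simp
qed

text \<open>\<open>k\<close> equal steps along the segment. The two conditions on \<open>T\<close> say that each step has an
  admissible length in time, the condition on \<open>k\<close> that the steps are short in space.\<close>

lemma constants_compare_along_segment:
  fixes x y :: "real ^ 'n"
  assumes s: "s = 1 \<or> s = -1" and l: "0 < l"
    and R: "\<And>r. 0 \<le> r \<Longrightarrow> r \<le> 1 \<Longrightarrow>
       parabolic_rectangle p (y + r *\<^sub>R (x - y)) (t - s * (r * T)) (\<sigma> * l) \<subseteq> \<Omega>"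
    and k: "0 < k" "\<And>i. \<bar>y $ i - x $ i\<bar> \<le> real k * l / 2"
    and T: "5 / 4 * l powr p * real k \<le> T" "T \<le> 3 / 2 * l powr p * real k"
  shows "s * (a y t l - a x (t - s * T) l) \<le> real k * (2 ^ (CARD('n) + 2) * B)"
proof -
  define X where "X j = y + (real j / real k) *\<^sub>R (x - y)" for j
  define \<tau> where "\<tau> j = t - s * (real j / real k * T)" for j
  have good: "parabolic_rectangle p (X j) (\<tau> j) (\<sigma> * l) \<subseteq> \<Omega>" if "j \<le> k" for j
    unfolding X_def \<tau>_def using that k(1) by (intro R) auto
  have "j \<le> k \<Longrightarrow> s * (a y t l - a (X j) (\<tau> j) l) \<le> real j * (2 ^ (CARD('n) + 2) * B)" for j
  proof (induction j)
    case 0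
    then show ?case by (simp add: X_def \<tau>_def)
  next
    case (Suc j)
    have "s * (a (X j) (\<tau> j) l - a (X (Suc j)) (\<tau> (Suc j)) l) \<le> 2 ^ (CARD('n) + 2) * B"
    proof (rule constants_compare_one_step[OF s l good good])
      show "\<bar>X j $ i - X (Suc j) $ i\<bar> \<le> l / 2" for i
      proof -
        have "X j $ i - X (Suc j) $ i = (y $ i - x $ i) / real k"
          using k(1) by (simp add: X_def field_simps)
        then show ?thesis using k(1) k(2)[of i] by (simp only: abs_divide) (simp add: field_simps)
      qed
      show "\<tau> j - \<tau> (Suc j) = s * (T / real k)"
        using k(1) by (simp add: \<tau>_def field_simps)
      show "5 / 4 * l powr p \<le> T / real k" "T / real k \<le> 3 / 2 * l powr p"
        using k(1) T by (simp_all add: field_simps)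
    qed (use Suc.prems in auto)
    then show ?case using Suc by (simp add: algebra_simps)
  qed
  from this[of k] show ?thesis using k(1) by (simp add: X_def \<tau>_def)
qed

text \<open>The first summand accounts for the at most \<open>\<delta>\<^sup>-\<^sup>p + 1\<close> steps of a chain, the second
  for the final passage from size \<open>\<delta>L\<close> to size \<open>L / (8 \<sigma>)\<close>.\<close>

definition chain_const :: "real \<Rightarrow> real" where
  "chain_const \<delta> = ((\<delta> powr (-p) + 1) * 2 ^ (CARD('n) + 2)
      + 2 * ((1 / (8 * \<sigma> * \<delta>)) ^ CARD('n) * (1 / (8 * \<sigma> * \<delta>)) powr p)) * B"

lemma chain_const_nonneg: "0 < \<delta> \<Longrightarrow> 0 \<le> chain_const \<delta>"
  using B_nonneg sigma_gt_1 by (simp add: chain_const_def)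

text \<open>A small rectangle at the time offset \<open>r \<ge> L\<^sup>p / 4\<close> is first joined, by a segment of
  rectangles of its own size, to one centered on the time axis of the large rectangle, whose
  inner quarter sits in the middle of the outer quarter of the concentric rectangle of size
  \<open>\<kappa>L\<close>; a nested overlap then concludes. The factor \<open>8\<close> in \<open>\<kappa>\<close> makes the time
  extent \<open>(\<kappa>L)\<^sup>p \<le> L\<^sup>p / 8\<close> small compared to \<open>r\<close>, so that time of order \<open>L\<^sup>p\<close> is left for
  the chain.\<close>

lemma constants_compare_to_center:
  fixes x y :: "real ^ 'n"
  assumes s: "s = 1 \<or> s = -1" and L: "0 < L" and R: "parabolic_rectangle p x t L \<subseteq> \<Omega>"
    and d: "0 < \<delta>" "\<delta> \<le> 1 / 120" "\<delta> \<le> 1 / (8 * \<sigma>)" "\<delta> powr (p - 1) \<le> 1 / 24"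
    and xy: "\<And>i. \<bar>y $ i - x $ i\<bar> + \<sigma> * (\<delta> * L) / 2 \<le> L / 2"
    and r: "L powr p / 4 \<le> r" "r + (\<sigma> * (\<delta> * L)) powr p \<le> L powr p"
  shows "s * (a y (t + s * r) (\<delta> * L) - a x t (L / (8 * \<sigma>))) \<le> chain_const \<delta>"
proof -
  define P where "P = L powr p"
  define q where "q = \<delta> powr p"
  define \<kappa> where "\<kappa> = 1 / (8 * \<sigma>)"
  define w where "w = \<kappa> powr p"
  have P: "0 < P" and q: "0 < q" and k0: "0 < \<kappa>" "\<kappa> \<le> 1 / 8" and w: "0 < w"
    using L d sigma_gt_1 by (auto simp: P_def q_def \<kappa>_def w_def field_simps)
  have lp: "(\<delta> * L) powr p = q * P" "(\<kappa> * L) powr p = w * P"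
    using L d k0 by (auto simp: P_def q_def w_def powr_mult)
  have "w \<le> \<kappa> powr 1" unfolding w_def using k0 p_gt_1 by (intro powr_mono') auto
  then have w8: "w \<le> 1 / 8" using k0 by simp
  have "q = \<delta> * \<delta> powr (p - 1)" using d(1) by (simp add: q_def powr_mult_base)
  then have q24: "q \<le> \<delta> / 24" using mult_left_mono[OF d(4), of \<delta>] d(1) by simp
  have qw: "q \<le> w" unfolding q_def w_def \<kappa>_def using d p_gt_1 by (intro powr_mono2) auto
  have qs: "q \<le> 1 / 2880" using q24 d(2) by simp
  \<comment> \<open>\<open>T\<close> is the time to be spanned by the chain: after it, the inner quarter of the last small
    rectangle and the outer quarter of the rectangle of size \<open>\<kappa>L\<close> have the same midpoint.\<close>
  define T where "T = r - 3 / 4 * (w * P) - 3 / 4 * (q * P)"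
  have wP: "w * P \<le> P / 8" and qP: "q * P \<le> P / 2880"
    using mult_right_mono[OF w8, of P] mult_right_mono[OF qs, of P] P by auto
  have T8: "P / 8 \<le> T" using r(1) wP qP P unfolding T_def P_def[symmetric] by linarith
  have T0: "0 < T" using T8 P by simp
  have rP: "r \<le> P" using r(2) unfolding P_def[symmetric] by (smt (verit) powr_ge_zero)
  have "0 \<le> w * P" "0 \<le> q * P" using w q P by simp_all
  then have Tr: "T \<le> r" unfolding T_def by linarith
  define Z where "Z = 2 * T / (3 * (q * P))"
  \<comment> \<open>\<open>Z\<close> steps would have exactly the ideal length \<open>3/2 l\<^sup>p\<close> in time; rounding up shortens them
    to no less than \<open>5/4 l\<^sup>p\<close> because \<open>Z\<close> is large.\<close>
  define k where "k = nat \<lceil>Z\<rceil>"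
  have Z: "1 / (12 * q) \<le> Z" "Z \<le> 1 / q"
  proof -
    have "1 / (12 * q) = 2 * (P / 8) / (3 * (q * P))" using P q by (simp add: field_simps)
    also have "\<dots> \<le> Z" unfolding Z_def using T8 P q by (intro divide_right_mono) auto
    finally show "1 / (12 * q) \<le> Z" .
    have "Z \<le> 2 * P / (3 * (q * P))" unfolding Z_def using Tr rP P q by (intro divide_right_mono) auto
    also have "\<dots> \<le> 1 / q" using P q by (simp add: field_simps)
    finally show "Z \<le> 1 / q" .
  qed
  have Z0: "0 < Z" using Z(1) q by (smt (verit) zero_less_divide_1_iff mult_pos_pos)
  have k: "Z \<le> real k" "real k \<le> Z + 1" "0 < k" unfolding k_def using Z0 by linarith+
  have TZ: "T = 3 / 2 * (q * P) * Z" unfolding Z_def using P q by (simp add: field_simps)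
  \<comment> \<open>Here \<open>p > 1\<close> enters: there are enough time steps to cross the cube in space.\<close>
  have kd: "1 / \<delta> \<le> real k"
  proof -
    have "1 / \<delta> \<le> 1 / (12 * q)" using q24 d(1) q by (intro divide_left_mono) auto
    then show ?thesis using Z(1) k(1) by linarith
  qed
  have good: "parabolic_rectangle p (y + \<rho> *\<^sub>R (x - y)) (t + s * r - s * (\<rho> * T)) (\<sigma> * (\<delta> * L)) \<subseteq> \<Omega>"
    if "0 \<le> \<rho>" "\<rho> \<le> 1" for \<rho>
  proof -
    have "\<bar>(y + \<rho> *\<^sub>R (x - y)) $ i - x $ i\<bar> + \<sigma> * (\<delta> * L) / 2 \<le> L / 2" for i
    proof -
      have "(y + \<rho> *\<^sub>R (x - y)) $ i - x $ i = (1 - \<rho>) * (y $ i - x $ i)"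
        by (simp add: algebra_simps)
      then have "\<bar>(y + \<rho> *\<^sub>R (x - y)) $ i - x $ i\<bar> \<le> \<bar>y $ i - x $ i\<bar>"
        using that by (simp add: abs_mult mult_left_le_one_le)
      then show ?thesis using xy[of i] by linarith
    qed
    moreover have "\<bar>t + s * r - s * (\<rho> * T) - t\<bar> + (\<sigma> * (\<delta> * L)) powr p \<le> L powr p"
    proof -
      have "0 \<le> \<rho> * T" "\<rho> * T \<le> T" using that T0 by (auto simp: mult_left_le_one_le)
      then have "\<bar>t + s * r - s * (\<rho> * T) - t\<bar> \<le> r" using s Tr by auto
      then show ?thesis using r(2) by linarith
    qed
    ultimately show ?thesis by (rule parabolic_rectangle_subset[OF R])
  qed
  have "s * (a y (t + s * r) (\<delta> * L) - a x (t + s * r - s * T) (\<delta> * L))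
      \<le> real k * (2 ^ (CARD('n) + 2) * B)"
  proof (rule constants_compare_along_segment[OF s _ good k(3)])
    show "0 < \<delta> * L" using d L by simp
    show "\<bar>y $ i - x $ i\<bar> \<le> real k * (\<delta> * L) / 2" for i
    proof -
      have "1 \<le> real k * \<delta>" using kd d(1) by (simp add: field_simps)
      then have "L \<le> real k * \<delta> * L" using L by simp
      moreover have "0 \<le> \<sigma> * (\<delta> * L)" using sigma_gt_1 d L by simp
      ultimately show ?thesis using xy[of i] by (simp add: mult.assoc)
    qed
    show "T \<le> 3 / 2 * (\<delta> * L) powr p * real k"
      unfolding lp TZ using k(1) P q by simp
    have "5 / 4 * (q * P) * real k \<le> 5 / 4 * (q * P) * (Z + 1)"
      using k(2) P q by simp
    also have "\<dots> = 5 / 6 * T + 5 / 4 * (q * P)" using TZ by (simp add: algebra_simps)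
    also have "\<dots> \<le> T" using qP T8 P by linarith
    finally show "5 / 4 * (\<delta> * L) powr p * real k \<le> T" unfolding lp .
  qed
  moreover have "real k * (2 ^ (CARD('n) + 2) * B) \<le> (\<delta> powr (-p) + 1) * (2 ^ (CARD('n) + 2) * B)"
  proof -
    have "1 / q = \<delta> powr (-p)" by (simp add: q_def powr_minus_divide)
    then show ?thesis using k(2) Z(2) B_nonneg by (intro mult_right_mono) auto
  qed
  moreover have "s * (a x (t + s * r - s * T) (\<delta> * L) - a x t (\<kappa> * L))
      \<le> 2 * ((\<kappa> / \<delta>) ^ CARD('n) * (w / q)) * B"
  proof (rule constants_compare_by_overlap[OF s])
    show "0 < \<delta> * L" "0 < \<kappa> * L" using d k0 L by auto
    show "parabolic_rectangle p x (t + s * r - s * T) (\<sigma> * (\<delta> * L)) \<subseteq> \<Omega>"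
      using good[of 1] by simp
    have "(\<sigma> * (\<kappa> * L)) powr p \<le> L powr p"
      using sigma_gt_1 L p_gt_1 by (intro powr_mono2) (auto simp: \<kappa>_def)
    then show "parabolic_rectangle p x t (\<sigma> * (\<kappa> * L)) \<subseteq> \<Omega>"
      using sigma_gt_1 L by (intro parabolic_rectangle_subset[OF R]) (auto simp: \<kappa>_def)
    let ?U = "quarter p (-s) x (t + s * r - s * T) (\<delta> * L)"
    show "?U \<in> sets lebesgue" "?U \<subseteq> ?U" by simp_all
    have time: "t + s * r - s * T + - s * (3 / 4 * (q * P)) = t + s * (3 / 4 * (w * P))"
      by (simp add: T_def algebra_simps)
    have "\<delta> * L \<le> \<kappa> * L" using d(3) L unfolding \<kappa>_def by (intro mult_right_mono) auto
    moreover have "q * P \<le> w * P" using qw P by simp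
    ultimately show "?U \<subseteq> quarter p s x t (\<kappa> * L)"
      unfolding quarter_def lp time by (intro block_subset_block) auto
    show "emeasure lebesgue ?U = ennreal ((\<delta> * L) ^ CARD('n) * ((\<delta> * L) powr p / 2))"
      using d L by (intro emeasure_quarter) simp
    show "0 < (\<delta> * L) ^ CARD('n) * ((\<delta> * L) powr p / 2)" using d L by simp
    let ?K = "(\<kappa> / \<delta>) ^ CARD('n) * (w / q)"
    let ?m = "(\<delta> * L) ^ CARD('n) * ((\<delta> * L) powr p / 2)"
    have "\<delta> \<le> \<kappa>" using d(3) by (simp only: \<kappa>_def)
    then have "1 \<le> (\<kappa> / \<delta>) ^ CARD('n)" using d(1) by (intro one_le_power) simp
    moreover have "1 \<le> w / q" using qw q by simp
    ultimately have "1 * 1 \<le> ?K" by (intro mult_mono) auto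
    moreover have "0 \<le> ?m" using d L by simp
    ultimately show "?m \<le> ?K * ?m" using mult_right_mono[of 1 ?K ?m] by simp
    show "(\<kappa> * L) ^ CARD('n) * ((\<kappa> * L) powr p / 2) \<le> ?K * ?m"
      unfolding lp using d q by (simp add: power_divide power_mult_distrib field_simps)
  qed
  moreover have wq: "w / q = (\<kappa> / \<delta>) powr p" using k0 d by (simp add: w_def q_def powr_divide)
  ultimately have "s * (a y (t + s * r) (\<delta> * L) - a x t (\<kappa> * L)) \<le>
     (\<delta> powr (-p) + 1) * (2 ^ (CARD('n) + 2) * B) + 2 * ((\<kappa> / \<delta>) ^ CARD('n) * (\<kappa> / \<delta>) powr p) * B"
    unfolding right_diff_distrib wq by linarith
  also have "\<dots> = chain_const \<delta>" by (simp add: chain_const_def \<kappa>_def algebra_simps)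
  finally show ?thesis by (simp add: \<kappa>_def)
qed

section \<open>Self-improvement of the bound up to the boundary\<close>

text \<open>The integrand is cut off at \<open>M\<close> because absorbing the term \<open>c / 2\<close> below requires some finite
  \<open>c\<close> to start from, and \<open>v\<close> need not even be integrable over quarters that touch
  the boundary.\<close>

definition truncated_bound :: "real \<Rightarrow> real \<Rightarrow> bool" where
  "truncated_bound M c \<longleftrightarrow> (\<forall>s x t L. (s = 1 \<or> s = -1) \<longrightarrow> 0 < L \<longrightarrow> parabolic_rectangle p x t L \<subseteq> \<Omega> \<longrightarrow>
     (\<integral>\<^sup>+z\<in>quarter p s x t L. min (excess v s (a x t (L / (8 * \<sigma>))) z) (ennreal M) \<partial>lebesgue)
       \<le> ennreal (c * (L ^ CARD('n) * (L powr p / 2))))"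

lemma truncated_boundD:
  assumes "truncated_bound M c" "s = 1 \<or> s = -1" "0 < L" "parabolic_rectangle p x t L \<subseteq> \<Omega>"
  shows "(\<integral>\<^sup>+z\<in>quarter p s x t L. min (excess v s (a x t (L / (8 * \<sigma>))) z) (ennreal M) \<partial>lebesgue)
       \<le> ennreal (c * (L ^ CARD('n) * (L powr p / 2)))"
  using assms unfolding truncated_bound_def by blast

text \<open>The constant \<open>D\<close> must not depend on the truncation \<open>M\<close>: it collects \<open>B\<close> and the chain
  constants for relative sizes \<open>1 / N\<close> (tiles away from the boundary, where the constant
  of the tile's own rectangle is used) and \<open>1 / (8 \<sigma> N)\<close> (tiles near the boundary, where the
  constant of its shrunken concentric rectangle is used).\<close>

lemma truncated_bound_improves:
  obtains D where "0 \<le> D" "\<And>M c. 0 \<le> c \<Longrightarrow> truncated_bound M c \<Longrightarrow> truncated_bound M (D + c / 2)"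
proof -
  obtain N m K :: nat where grid: "2 * \<sigma> powr p \<le> real m" "2 * m \<le> N" "m \<le> K" "120 \<le> N"
    "8 * \<sigma> \<le> real N" "(1 / real N) powr (p - 1) \<le> 1 / 24"
    "real N powr p \<le> real K" "real K \<le> real N powr p + 1"
    "real (N ^ CARD('n) * K) - real ((N - 2 * m) ^ CARD('n) * (K - m))
       \<le> 1 / 2 * (real N ^ CARD('n) * real N powr p)"
    using ex_fine_grid[OF p_gt_1 sigma_gt_1, where n = "CARD('n)"] .
  define d1 where "d1 = 1 / real N"
  define d2 where "d2 = 1 / (8 * \<sigma>) * d1"
  have N0: "0 < real N" using grid(4) by simp
  have d1: "0 < d1" "d1 \<le> 1 / 120" "d1 \<le> 1 / (8 * \<sigma>)" "d1 powr (p - 1) \<le> 1 / 24"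
    using grid(4,5,6) sigma_gt_1 N0 by (simp_all add: d1_def field_simps)
  have d2: "0 < d2" "d2 \<le> d1"
    using d1(1) sigma_gt_1 by (simp_all add: d2_def field_simps)
  have d2': "d2 powr (p - 1) \<le> 1 / 24"
    using powr_mono2[of "p - 1" d2 d1] p_gt_1 d1(4) d2 by simp
  define C where "C = B + chain_const d1 + chain_const d2"
  have C: "0 \<le> C" "B + chain_const d1 \<le> C" "chain_const d2 \<le> C"
    using chain_const_nonneg[OF d1(1)] chain_const_nonneg[OF d2(1)] B_nonneg by (auto simp: C_def)
  have Np4: "4 \<le> real N powr p"
  proof -
    have "real N powr 1 \<le> real N powr p" using grid(4) p_gt_1 by (intro powr_mono) auto
    then show ?thesis using grid(4) by simp
  qed
  have sp: "\<sigma> \<le> \<sigma> powr p" using powr_mono[of 1 p \<sigma>] sigma_gt_1 p_gt_1 by simp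
  have "truncated_bound M (2 * C + c / 2)" if c: "0 \<le> c" and IH: "truncated_bound M c" for M c
    unfolding truncated_bound_def
  proof (intro allI impI)
    fix s :: real and x :: "real ^ 'n" and t L
    assume s: "s = 1 \<or> s = -1" and L: "0 < L" and R: "parabolic_rectangle p x t L \<subseteq> \<Omega>"
    define l where "l = L / real N"
    define h where "h = l powr p / 2"
    define A where "A = a x t (L / (8 * \<sigma>))"
    define r where "r j = L powr p - (real j + 2) * h" for j :: nat
    define y where "y i = subcube_center x L N i" for i
    define V where "V = l ^ CARD('n) * (l powr p / 2)"
    define f where "f z = min (excess v s A z) (ennreal M)" for z
    have f[measurable]: "f \<in> borel_measurable lebesgue" unfolding f_def[abs_def] by measurable
    have l: "0 < l" "l * real N = L" and h: "0 < h" using L N0 by (auto simp: l_def h_def)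
    have V: "0 < V" "real N ^ CARD('n) * real N powr p * V = L ^ CARD('n) * (L powr p / 2)"
      using l by (simp_all add: V_def power_mult_distrib powr_mult flip: l(2))
    have lp: "l powr p = 2 * h" by (simp add: h_def)
    have Lp: "L powr p = 2 * (real N powr p * h)"
      using l by (simp add: h_def powr_mult flip: l(2))
    have y: "\<bar>y i $ k - x $ k\<bar> = \<bar>real (i k) + 1 / 2 - real N / 2\<bar> * l" for i k
    proof -
      have "y i $ k - x $ k = (real (i k) + 1 / 2 - real N / 2) * l"
        using l(2) by (simp add: y_def subcube_center_def flip: l_def) (simp add: algebra_simps)
      then show ?thesis using l(1) by (simp add: abs_mult)
    qed
    have y_dist: "\<bar>y i $ k - x $ k\<bar> + \<rho> * l / 2 \<le> L / 2"
      if "\<rho> / 2 \<le> real (i k) + 1 / 2" "real (i k) + 1 / 2 + \<rho> / 2 \<le> real N" for i k \<rho>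
    proof -
      have "\<bar>real (i k) + 1 / 2 - real N / 2\<bar> + \<rho> / 2 \<le> real N / 2" using that by linarith
      then have "(\<bar>real (i k) + 1 / 2 - real N / 2\<bar> + \<rho> / 2) * l \<le> real N / 2 * l"
        using l(1) by (intro mult_right_mono) auto
      then show ?thesis unfolding y using l(2) by (simp add: algebra_simps)
    qed
    have r_low: "L powr p / 4 \<le> r j" if "j < K" for j
    proof -
      have "real j + 2 \<le> real N powr p + 2" using that grid(8) by linarith
      then have "(real j + 2) * h \<le> (real N powr p + 2) * h" using h by simp
      moreover have "4 * h \<le> real N powr p * h" using Np4 h by simp
      ultimately show ?thesis unfolding r_def Lp by (simp add: algebra_simps)
    qed
    have r_nonneg: "0 \<le> r j" if "j < K" for j
      using r_low[OF that] powr_ge_zero[of L p] by linarith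
    have r_high: "r j + l powr p \<le> L powr p" for j
      using h by (simp add: r_def lp algebra_simps)
    \<comment> \<open>\<open>I\<close> indexes all tiles, \<open>G\<close> those whose rectangle stays in \<open>R\<close> when dilated
      by \<open>\<sigma>\<close>. Near the inner end of the quarter there is always room.\<close>
    define I where "I = {i :: 'n \<Rightarrow> nat. \<forall>c. i c \<in> {..<N}} \<times> {..<K}"
    define G where "G = {i :: 'n \<Rightarrow> nat. \<forall>c. i c \<in> {m..<N - m}} \<times> {m..<K}"
    have fin: "finite I" "finite G" and cI: "card I = N ^ CARD('n) * K"
      and cG: "card G = (N - 2 * m) ^ CARD('n) * (K - m)"
      unfolding I_def G_def card_cartesian_product
      by (simp_all only: card_functions_into finite_cartesian_product finite_lessThan
          finite_atLeastLessThan card_lessThan card_atLeastLessThan) (simp add: mult_2)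
    have GI: "G \<subseteq> I" by (auto simp: G_def I_def intro: less_le_trans[OF _ diff_le_self])
    have tile: "(\<integral>\<^sup>+z\<in>quarter p s (y i) (t + s * r j) l. f z \<partial>lebesgue)
        \<le> ennreal ((C + (if (i, j) \<in> G then 0 else c)) * V)" if ij: "(i, j) \<in> I" for i j
    proof -
      have ik: "i k < N" for k using ij by (auto simp: I_def)
      have j: "j < K" using ij by (auto simp: I_def)
      have emQ: "emeasure lebesgue (quarter p s (y i) (t + s * r j) l) = ennreal V"
        unfolding V_def by (rule emeasure_quarter[OF l(1)])
      show ?thesis
      proof (cases "(i, j) \<in> G")
        case True
        then have ik': "m \<le> i k" "i k + m < N" for k
          using grid(2) by (auto simp: G_def less_diff_conv)
        have j': "m \<le> j" using True by (auto simp: G_def)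
        have m\<sigma>: "\<sigma> \<le> real m" using sp grid(1) sigma_gt_1 by linarith
        have space: "\<bar>y i $ k - x $ k\<bar> + \<sigma> * l / 2 \<le> L / 2" for k
        proof (rule y_dist)
          have "real m \<le> real (i k)" "real (i k) + real m + 1 \<le> real N" using ik'[of k] by linarith+
          then show "\<sigma> / 2 \<le> real (i k) + 1 / 2" "real (i k) + 1 / 2 + \<sigma> / 2 \<le> real N"
            using m\<sigma> sigma_gt_1 by linarith+
        qed
        have "2 * \<sigma> powr p * h \<le> (real j + 2) * h"
          using grid(1) j' h by (intro mult_right_mono) auto
        then have time: "r j + (\<sigma> * l) powr p \<le> L powr p"
          using l sigma_gt_1 by (simp add: r_def powr_mult lp)
        have d1l: "d1 * L = l" by (simp add: d1_def l_def)
        have R': "parabolic_rectangle p (y i) (t + s * r j) (\<sigma> * l) \<subseteq> \<Omega>"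
        proof -
          have "\<bar>t + s * r j - t\<bar> + (\<sigma> * l) powr p \<le> L powr p" using s time r_nonneg[OF j] by auto
          with space show ?thesis by (rule parabolic_rectangle_subset[OF R])
        qed
        have "s * (a (y i) (t + s * r j) l - A) \<le> chain_const d1"
          using constants_compare_to_center[OF s L R d1, of "y i" "r j"] space time r_low[OF j]
          unfolding d1l A_def by simp
        then have "excess v s A z \<le> excess v s (a (y i) (t + s * r j) l) z + ennreal (chain_const d1)" for z
          using chain_const_nonneg[OF d1(1)] by (intro excess_le_excess_plus) simp_all
        then have "f z \<le> excess v s (a (y i) (t + s * r j) l) z + ennreal (chain_const d1)" for z
          by (simp add: f_def min.coboundedI1)
        then have "(\<integral>\<^sup>+z\<in>quarter p s (y i) (t + s * r j) l. f z \<partial>lebesgue)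
            \<le> ennreal ((B + chain_const d1) * V)"
          using bound[OF s l(1) R'] emQ B_nonneg chain_const_nonneg[OF d1(1)] V(1)
          by (intro set_nn_integral_le_add_const) (auto simp: V_def)
        also have "\<dots> \<le> ennreal ((C + (if (i, j) \<in> G then 0 else c)) * V)"
          using True C V(1) by (intro ennreal_leI) simp
        finally show ?thesis .
      next
        case False
        have space: "\<bar>y i $ k - x $ k\<bar> + l / 2 \<le> L / 2" for k
          using y_dist[of 1 i k] ik[of k] by simp
        have d2l: "d2 * L = l / (8 * \<sigma>)" by (simp add: d2_def d1_def l_def)
        have sl: "\<sigma> * (l / (8 * \<sigma>)) = l / 8" using sigma_gt_1 by simp
        have R': "parabolic_rectangle p (y i) (t + s * r j) l \<subseteq> \<Omega>"
        proof -
          have "\<bar>t + s * r j - t\<bar> + l powr p \<le> L powr p" using s r_high[of j] r_nonneg[OF j] by auto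
          with space show ?thesis by (rule parabolic_rectangle_subset[OF R])
        qed
        have "(l / 8) powr p \<le> l powr p" using l p_gt_1 by (intro powr_mono2) auto
        then have "r j + (l / 8) powr p \<le> L powr p" using r_high[of j] by linarith
        moreover have "\<bar>y i $ k - x $ k\<bar> + l / 8 / 2 \<le> L / 2" for k using space[of k] l(1) by linarith
        ultimately have "s * (a (y i) (t + s * r j) (l / (8 * \<sigma>)) - A) \<le> chain_const d2"
          using constants_compare_to_center[OF s L R d2(1) _ _ d2', of "y i" "r j"] r_low[OF j] d1 d2
          unfolding d2l A_def sl by simp
        then have "excess v s A z \<le> excess v s (a (y i) (t + s * r j) (l / (8 * \<sigma>))) z + ennreal (chain_const d2)" for z
          using chain_const_nonneg[OF d2(1)] by (intro excess_le_excess_plus) simp_all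
        then have "f z \<le> min (excess v s (a (y i) (t + s * r j) (l / (8 * \<sigma>))) z) (ennreal M) + ennreal (chain_const d2)" for z
          unfolding f_def by (rule min_le_min_plus)
        then have "(\<integral>\<^sup>+z\<in>quarter p s (y i) (t + s * r j) l. f z \<partial>lebesgue)
            \<le> ennreal ((c + chain_const d2) * V)"
        proof (rule set_nn_integral_le_add_const)
          show "(\<integral>\<^sup>+z\<in>quarter p s (y i) (t + s * r j) l.
              min (excess v s (a (y i) (t + s * r j) (l / (8 * \<sigma>))) z) (ennreal M) \<partial>lebesgue)
            \<le> ennreal (c * V)"
            unfolding V_def by (rule truncated_boundD[OF IH s l(1) R'])
        qed (use emQ c chain_const_nonneg[OF d2(1)] V(1) in \<open>simp_all\<close>)
        also have "\<dots> \<le> ennreal ((C + (if (i, j) \<in> G then 0 else c)) * V)"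
          using False C V(1) by (intro ennreal_leI mult_right_mono) auto
        finally show ?thesis .
      qed
    qed
    define T where "T ij = closed_block (y (fst ij)) l
        (t + s * r (snd ij) + s * (3 / 4 * l powr p)) (l powr p / 4)" for ij
    have "(\<integral>\<^sup>+z\<in>quarter p s x t L. f z \<partial>lebesgue) \<le> (\<Sum>ij\<in>I. \<integral>\<^sup>+z\<in>T ij. f z \<partial>lebesgue)"
    proof (rule nn_integral_finite_cover[OF fin(1) _ f])
      have "0 < N" using grid(4) by simp
      from quarter_subset_tiles[OF s L this grid(7), of x t]
      show "quarter p s x t L \<subseteq> (\<Union>ij\<in>I. T ij)"
        unfolding I_def T_def y_def r_def h_def l_def by (simp add: case_prod_beta')
    qed (simp add: T_def)
    also have "\<dots> = (\<Sum>ij\<in>I. \<integral>\<^sup>+z\<in>quarter p s (y (fst ij)) (t + s * r (snd ij)) l. f z \<partial>lebesgue)"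
      by (simp add: T_def nn_integral_closed_block quarter_def)
    also have "\<dots> \<le> (\<Sum>ij\<in>I. ennreal ((C + (if ij \<in> G then 0 else c)) * V))"
      using tile[where i = "fst ij" and j = "snd ij" for ij]
      by (intro sum_mono) (simp only: prod.collapse)
    also have "\<dots> = ennreal (\<Sum>ij\<in>I. (C + (if ij \<in> G then 0 else c)) * V)"
      using C c V(1) by (intro sum_ennreal) auto
    also have "(\<Sum>ij\<in>I. (C + (if ij \<in> G then 0 else c)) * V)
        = (real (card I) * C + (real (card I) - real (card G)) * c) * V"
    proof -
      have "(\<Sum>ij\<in>I. if ij \<in> G then 0 else c) = (\<Sum>ij\<in>I - G. c)"
        using fin by (intro sum.mono_neutral_cong_right) auto
      also have "\<dots> = (real (card I) - real (card G)) * c"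
        using fin GI by (simp add: card_Diff_subset card_mono of_nat_diff)
      finally show ?thesis by (simp add: sum_distrib_right[symmetric] sum.distrib)
    qed
    also have "\<dots> \<le> (2 * C + c / 2) * (L ^ CARD('n) * (L powr p / 2))"
    proof -
      define W where "W = real N ^ CARD('n) * real N powr p"
      have "real (card I) \<le> real N ^ CARD('n) * (2 * real N powr p)"
        unfolding cI of_nat_mult of_nat_power using grid(8) Np4 by (intro mult_left_mono) auto
      then have "real (card I) * C \<le> 2 * W * C" using C(1) by (intro mult_right_mono) (auto simp: W_def)
      moreover have "(real (card I) - real (card G)) * c \<le> 1 / 2 * W * c"
        unfolding cI cG W_def using grid(9) c by (intro mult_right_mono) auto
      ultimately have "(real (card I) * C + (real (card I) - real (card G)) * c) * V
          \<le> (2 * W * C + 1 / 2 * W * c) * V"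
        using V(1) by (intro mult_right_mono) linarith+
      also have "\<dots> = (2 * C + c / 2) * (W * V)" by (simp add: algebra_simps)
      finally show ?thesis using V(2) by (simp add: W_def)
    qed
    finally show "(\<integral>\<^sup>+z\<in>quarter p s x t L. min (excess v s (a x t (L / (8 * \<sigma>))) z) (ennreal M) \<partial>lebesgue)
       \<le> ennreal ((2 * C + c / 2) * (L ^ CARD('n) * (L powr p / 2)))"
      unfolding f_def A_def by (simp add: ennreal_leI)
  qed
  then show ?thesis using C(1) by (intro that[of "2 * C"]) auto
qed

lemma truncated_bound_mono:
  assumes "truncated_bound M c" "c \<le> c'"
  shows "truncated_bound M c'"
  unfolding truncated_bound_def
proof (intro allI impI)
  fix s :: real and x :: "real ^ 'n" and t L
  assume *: "s = 1 \<or> s = -1" "0 < L" "parabolic_rectangle p x t L \<subseteq> \<Omega>"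
  have "(\<integral>\<^sup>+z\<in>quarter p s x t L. min (excess v s (a x t (L / (8 * \<sigma>))) z) (ennreal M) \<partial>lebesgue)
       \<le> ennreal (c * (L ^ CARD('n) * (L powr p / 2)))"
    using assms(1) * unfolding truncated_bound_def by blast
  also have "\<dots> \<le> ennreal (c' * (L ^ CARD('n) * (L powr p / 2)))"
    using *(2) assms(2) by (intro ennreal_leI mult_right_mono) auto
  finally show "(\<integral>\<^sup>+z\<in>quarter p s x t L. min (excess v s (a x t (L / (8 * \<sigma>))) z) (ennreal M) \<partial>lebesgue)
       \<le> ennreal (c' * (L ^ CARD('n) * (L powr p / 2)))" .
qed

text \<open>Starting from the trivial bound \<open>M\<close>, \<open>k\<close> improvements give \<open>2 D + M / 2\<^sup>k\<close>. Taking \<open>k\<close> large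
  leaves a bound independent of \<open>M\<close>.\<close>

lemma oscillation_bound_up_to_boundary:
  obtains c where "0 \<le> c"
    "\<And>s x t L. \<lbrakk>s = 1 \<or> s = -1; 0 < L; parabolic_rectangle p x t L \<subseteq> \<Omega>\<rbrakk> \<Longrightarrow>
     (\<integral>\<^sup>+z\<in>quarter p s x t L. excess v s (a x t (L / (8 * \<sigma>))) z \<partial>lebesgue)
       \<le> ennreal (c * (L ^ CARD('n) * (L powr p / 2)))"
proof -
  obtain D where D: "0 \<le> D" "\<And>M c. 0 \<le> c \<Longrightarrow> truncated_bound M c \<Longrightarrow> truncated_bound M (D + c / 2)"
    using truncated_bound_improves by blast
  have trunc: "truncated_bound (real M) (2 * D + 1)" for M :: nat
  proof -
    have "truncated_bound (real M) (2 * D + real M / 2 ^ k)" for k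
    proof (induction k)
      case 0
      have "truncated_bound (real M) (real M)"
        unfolding truncated_bound_def
      proof (intro allI impI)
        fix s :: real and x :: "real ^ 'n" and t L :: real
        assume L: "0 < L"
        have "(\<integral>\<^sup>+z\<in>quarter p s x t L. min (excess v s (a x t (L / (8 * \<sigma>))) z) (ennreal (real M)) \<partial>lebesgue)
          \<le> (\<integral>\<^sup>+z\<in>quarter p s x t L. ennreal (real M) \<partial>lebesgue)"
          by (intro nn_integral_mono mult_right_mono) auto
        also have "\<dots> = ennreal (real M * (L ^ CARD('n) * (L powr p / 2)))"
          using L by (subst nn_integral_cmult_indicator)
            (simp_all only: sets_quarter emeasure_quarter ennreal_mult[symmetric] of_nat_0_le_iff
              mult_nonneg_nonneg zero_le_power less_imp_le powr_ge_zero divide_nonneg_pos zero_less_numeral)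
        finally show "(\<integral>\<^sup>+z\<in>quarter p s x t L. min (excess v s (a x t (L / (8 * \<sigma>))) z) (ennreal (real M)) \<partial>lebesgue)
          \<le> ennreal (real M * (L ^ CARD('n) * (L powr p / 2)))" .
      qed
      then show ?case using D(1) by (rule_tac truncated_bound_mono) auto
    next
      case (Suc k)
      have "truncated_bound (real M) (D + (2 * D + real M / 2 ^ k) / 2)"
        using Suc D by (intro D(2)) auto
      then show ?case by (simp add: field_simps)
    qed
    moreover obtain k :: nat where "real M < 2 ^ k" using real_arch_pow[of 2 "real M"] by auto
    ultimately show ?thesis by (rule_tac truncated_bound_mono[of _ "2 * D + real M / 2 ^ k"]) auto
  qed
  show ?thesis
  proof (rule that[of "2 * D + 1"])
    fix s :: real and x :: "real ^ 'n" and t L :: real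
    assume s: "s = 1 \<or> s = -1" and L: "0 < L" and R: "parabolic_rectangle p x t L \<subseteq> \<Omega>"
    let ?e = "excess v s (a x t (L / (8 * \<sigma>)))" and ?Q = "quarter p s x t L"
    have sup: "(SUP M::nat. min (?e z) (ennreal (real M)) * indicator ?Q z) = ?e z * indicator ?Q z" for z
    proof (rule antisym)
      show "(SUP M::nat. min (?e z) (ennreal (real M)) * indicator ?Q z) \<le> ?e z * indicator ?Q z"
        by (intro SUP_least mult_right_mono) auto
      obtain M :: nat where "max (s * (v z - a x t (L / (8 * \<sigma>)))) 0 \<le> real M"
        using real_arch_simple by blast
      then have "?e z \<le> ennreal (real M)" unfolding excess_def by (rule ennreal_leI)
      then have "?e z * indicator ?Q z = min (?e z) (ennreal (real M)) * indicator ?Q z"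
        by (simp add: min_absorb1)
      also have "\<dots> \<le> (SUP M::nat. min (?e z) (ennreal (real M)) * indicator ?Q z)"
        by (intro SUP_upper) simp
      finally show "?e z * indicator ?Q z \<le> (SUP M::nat. min (?e z) (ennreal (real M)) * indicator ?Q z)" .
    qed
    have "(\<integral>\<^sup>+z\<in>?Q. ?e z \<partial>lebesgue)
        = (\<integral>\<^sup>+z. (SUP M::nat. min (?e z) (ennreal (real M)) * indicator ?Q z) \<partial>lebesgue)"
      by (intro nn_integral_cong sup[symmetric])
    also have "\<dots> = (SUP M::nat. \<integral>\<^sup>+z. min (?e z) (ennreal (real M)) * indicator ?Q z \<partial>lebesgue)"
    proof (rule nn_integral_monotone_convergence_SUP)
      show "incseq (\<lambda>M::nat. \<lambda>z. min (?e z) (ennreal (real M)) * indicator ?Q z)"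
        by (intro incseq_SucI le_funI mult_right_mono min.mono ennreal_leI) auto
    qed measurable
    also have "\<dots> \<le> ennreal ((2 * D + 1) * (L ^ CARD('n) * (L powr p / 2)))"
      using trunc s L R by (intro SUP_least) (auto simp: truncated_bound_def)
    finally show "(\<integral>\<^sup>+z\<in>?Q. ?e z \<partial>lebesgue) \<le> ennreal ((2 * D + 1) * (L ^ CARD('n) * (L powr p / 2)))" .
  qed (use D(1) in simp)
qed

end

theorem theorem5p3:
  fixes p \<sigma> :: real
    and \<Omega> :: "((real ^ 'n) \<times> real) set"
    and u :: "(real ^ 'n) \<times> real \<Rightarrow> real"
  assumes "p > 1"
    and "open \<Omega>" and "connected \<Omega>" and "\<Omega> \<noteq> {}"
    and "\<sigma> > 1"
    and "u \<in> PBMO p \<sigma> \<Omega>"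
  shows "u \<in> PBMO p 1 \<Omega>"
proof -
  define v where "v z = indicator \<Omega> z * u z" for z
  have loc: "locally_integrable_on u \<Omega>" using assms(6) by (simp add: PBMO_def)
  have v: "v \<in> borel_measurable lebesgue"
    unfolding v_def[abs_def] by (rule locally_integrable_measurable[OF loc assms(2)])
  have quarter_in: "quarter p s x t L \<subseteq> \<Omega>"
    if "parabolic_rectangle p x t (\<rho> * L) \<subseteq> \<Omega>" "1 \<le> \<rho>" "0 < L" "s = 1 \<or> s = -1" for s \<rho> L t and x :: "real ^ 'n"
  proof -
    have "L powr p \<le> (\<rho> * L) powr p" using that assms(1) by (intro powr_mono2) auto
    moreover have "L \<le> \<rho> * L" using that by simp
    ultimately have "quarter p s x t L \<subseteq> parabolic_rectangle p x t (\<rho> * L)"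
      using that(4) unfolding quarter_def parabolic_rectangle_eq_block
      by (intro block_subset_block) auto
    then show ?thesis using that(1) by blast
  qed
  have mean: "mean_pos_part (quarter p s x t L) (\<lambda>z. s * (u z - c))
      = (\<integral>\<^sup>+z\<in>quarter p s x t L. excess v s c z \<partial>lebesgue) / ennreal (L ^ CARD('n) * (L powr p / 2))"
    if "quarter p s x t L \<subseteq> \<Omega>" "0 < L" for s c L t and x :: "real ^ 'n"
    unfolding mean_pos_part_def emeasure_quarter[OF that(2)]
    using that(1) by (intro arg_cong2[where f = "(/)"] nn_integral_cong)
      (auto simp: excess_def v_def indicator_def)
  have upper: "mean_pos_part (upper_quarter p x t L) (\<lambda>z. u z - c)
      = mean_pos_part (quarter p 1 x t L) (\<lambda>z. 1 * (u z - c))"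
    and lower: "mean_pos_part (lower_quarter p x t L) (\<lambda>z. c - u z)
      = mean_pos_part (quarter p (-1) x t L) (\<lambda>z. -1 * (u z - c))" for x :: "real ^ 'n" and t L c
    by (simp_all add: upper_quarter_eq_quarter lower_quarter_eq_quarter)
  obtain a S where S: "S < \<infinity>"
    "\<And>x t L. 0 < L \<Longrightarrow> parabolic_rectangle p x t (\<sigma> * L) \<subseteq> \<Omega> \<Longrightarrow>
       mean_pos_part (upper_quarter p x t L) (\<lambda>z. u z - a x t L) +
       mean_pos_part (lower_quarter p x t L) (\<lambda>z. a x t L - u z) \<le> S"
  proof -
    from assms(6) obtain a where
      "(SUP (x, t, L) \<in> {(x, t, L). L > 0 \<and> parabolic_rectangle p x t (\<sigma> * L) \<subseteq> \<Omega>}.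
                  mean_pos_part (upper_quarter p x t L) (\<lambda>z. u z - a x t L) +
                  mean_pos_part (lower_quarter p x t L) (\<lambda>z. a x t L - u z)) < \<infinity>"
      (is "?S < _") by (auto simp: PBMO_def)
    then show ?thesis by (rule that) (rule SUP_upper2, auto)
  qed
  define B where "B = enn2real S"
  have B0: "0 \<le> B" by (simp add: B_def)
  have SB: "S = ennreal B" using S(1) by (simp add: B_def)
  interpret interior_oscillation_bound p \<sigma> B \<Omega> v a
  proof
    fix s :: real and L t and x :: "real ^ 'n"
    assume s: "s = 1 \<or> s = -1" and L: "0 < L" and R: "parabolic_rectangle p x t (\<sigma> * L) \<subseteq> \<Omega>"
    let ?V = "L ^ CARD('n) * (L powr p / 2)"
    have V: "0 < ?V" using L by simp
    have Q: "quarter p s x t L \<subseteq> \<Omega>" using quarter_in[OF R _ L s] assms(5) by simp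
    have "mean_pos_part (quarter p s x t L) (\<lambda>z. s * (u z - a x t L)) \<le> ennreal B"
      using S(2)[OF L R] s unfolding upper lower SB
      by (auto intro: order_trans[rotated] simp: add_increasing add_increasing2)
    then have "(\<integral>\<^sup>+z\<in>quarter p s x t L. excess v s (a x t L) z \<partial>lebesgue) / ennreal ?V \<le> ennreal B"
      unfolding mean[OF Q L] .
    then have "(\<integral>\<^sup>+z\<in>quarter p s x t L. excess v s (a x t L) z \<partial>lebesgue) / ennreal ?V * ennreal ?V
        \<le> ennreal B * ennreal ?V"
      by (rule mult_right_mono) simp
    then have "(\<integral>\<^sup>+z\<in>quarter p s x t L. excess v s (a x t L) z \<partial>lebesgue) \<le> ennreal B * ennreal ?V"
      using V by (simp only: ennreal_divide_times ennreal_divide_self ennreal_less_top mult_1_right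
          ennreal_eq_0_iff not_le not_False_eq_True)
    then show "(\<integral>\<^sup>+z\<in>quarter p s x t L. excess v s (a x t L) z \<partial>lebesgue) \<le> ennreal (B * ?V)"
      using V B0 by (simp only: ennreal_mult less_imp_le)
  qed (use assms v in \<open>auto simp: B_def\<close>)
  obtain c where c: "0 \<le> c"
    "\<And>s x t L. \<lbrakk>s = 1 \<or> s = -1; 0 < L; parabolic_rectangle p x t L \<subseteq> \<Omega>\<rbrakk> \<Longrightarrow>
     (\<integral>\<^sup>+z\<in>quarter p s x t L. excess v s (a x t (L / (8 * \<sigma>))) z \<partial>lebesgue)
       \<le> ennreal (c * (L ^ CARD('n) * (L powr p / 2)))"
    using oscillation_bound_up_to_boundary by blast
  have part: "mean_pos_part (quarter p s x t L) (\<lambda>z. s * (u z - a x t (L / (8 * \<sigma>)))) \<le> ennreal c"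
    if s: "s = 1 \<or> s = -1" and L: "0 < L" and R: "parabolic_rectangle p x t L \<subseteq> \<Omega>"
    for s L t and x :: "real ^ 'n"
  proof -
    have Q: "quarter p s x t L \<subseteq> \<Omega>" using quarter_in[of x t 1 L s] s L R by simp
    show ?thesis unfolding mean[OF Q L]
    proof (rule divide_le_posI_ennreal)
      show "0 < ennreal (L ^ CARD('n) * (L powr p / 2))" using L by simp
      have "ennreal (L ^ CARD('n) * (L powr p / 2)) * ennreal c
          = ennreal (c * (L ^ CARD('n) * (L powr p / 2)))"
        using c(1) L by (subst ennreal_mult[symmetric]) (simp_all add: mult.commute)
      then show "(\<integral>\<^sup>+z\<in>quarter p s x t L. excess v s (a x t (L / (8 * \<sigma>))) z \<partial>lebesgue)
          \<le> ennreal (L ^ CARD('n) * (L powr p / 2)) * ennreal c"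
        using c(2)[OF s L R] by simp
    qed
  qed
  have "(SUP (x, t, L) \<in> {(x, t, L). L > 0 \<and> parabolic_rectangle p x t (1 * L) \<subseteq> \<Omega>}.
      mean_pos_part (upper_quarter p x t L) (\<lambda>z. u z - a x t (L / (8 * \<sigma>))) +
      mean_pos_part (lower_quarter p x t L) (\<lambda>z. a x t (L / (8 * \<sigma>)) - u z)) \<le> ennreal c + ennreal c"
    unfolding upper lower using part[of 1] part[of "-1"]
    by (intro SUP_least) (auto intro!: add_mono)
  also have "\<dots> < \<infinity>" by simp
  finally show ?thesis
    using loc unfolding PBMO_def mem_Collect_eq
    by (intro conjI exI[of _ "\<lambda>x t L. a x t (L / (8 * \<sigma>))"])
qed

end
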